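(* For a $k$-element subset $M\subset J$, let $\mathrm{Jac}_M$ be the Jacobian (determinant) of the projection $\Lambda\to\mathbb C^n-\Delta$, $(z,p)\mapsto z$, with respect to the ordered coordinate system $z_M,p_{\bar M}$ on $\Lambda$ and the ordered coordinate system $z_1,\dots,z_n$ on $\mathbb C^n-\Delta$. Then, as a function on $\Lambda$, the function $d_M^2\,\mathrm{Jac}_M$ does not depend on $M$, and $$d_M^2\,\mathrm{Jac}_M=(-1)^{n-k}\sum_{L\subset J,\ |L|=n-k}d_{\bar L}^2\prod_{j\in L}\frac{a_j}{p_j^2}.$$
   Context: Let $n>k$ be positive integers, $J=\{1,\dots,n\}$. Let $t_1,\dots,t_k$ be coordinates on $\mathbb C^k$ and $z_1,\dots,z_n$ coordinates on $\mathbb C^n$. Fix linear functions $g_j=\sum_{m=1}^k b_j^m t_m$, $j\in J$, with $b_j^m\in\mathbb C$, and put $d_{i_1,\dots,i_k}=\det_{\ell,m=1}^k(b^m_{i_\ell})$. Assume $d_{i_1,\dots,i_k}\neq0$ whenever $i_1,\dots,i_k\in J$ are distinct. For a $k$-element subset $I=\{i_1,\dots,i_k\}\subset J$ put $d_I^2=(d_{i_1,\dots,i_k})^2$. For a subset $L\subset J$, $\bar L=J\setminus L$. Put $f_j(z,t)=z_j+g_j(t)$ on $\mathbb C^n\times\mathbb C^k$. For distinct $i_1,\dots,i_{k+1}\in J$ put $$f_{i_1,\dots,i_{k+1}}(z)=\sum_{m=1}^{k+1}(-1)^{m-1}d_{i_1,\dots,\widehat{i_m},\dots,i_{k+1}}z_{i_m},$$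 and let $\Delta\subset\mathbb C^n$ be the union over all $(k+1)$-element subsets $\{i_1<\dots<i_{k+1}\}\subset J$ of the hyperplanes $f_{i_1,\dots,i_{k+1}}(z)=0$. Fix nonzero weights $a_j\in\mathbb C^\times$, $j\in J$, with $|a|=\sum_{j\in J}a_j\neq0$. The master function is $\Phi(z,t)=\sum_{j\in J}a_j\log f_j(z,t)$. Let $U^0=\{(z,t)\in\mathbb C^n\times\mathbb C^k : z\notin\Delta,\ f_j(z,t)\ne0\ \text{for all } j\in J\}$ and $C_\Phi=\{(z,t)\in U^0: \partial\Phi/\partial t_i(z,t)=0,\ i=1,\dots,k\}$. Consider the map $\phi:C_\Phi\to(\mathbb C^n-\Delta)\times(\mathbb C^\times)^n$, $(z,t)\mapsto(z_1,\dots,z_n,p_1,\dots,p_n)$ with $p_j=\frac{\partial\Phi}{\partial z_j}(z,t)=a_j/f_j(z,t)$, and put $\Lambda=\phi(C_\Phi)$, a smooth $n$-dimensional variety. For any $k$-element subset $M\subset J$, the functions $z_M=\{z_i: i\in M\}$, $p_{\bar M}=\{p_j: j\in\bar M\}$ form a system of coordinates on $\Lambda$; these functions are ordered by increasing index (e.g. for $k=3$, $n=6$, $M=\{1,3,6\}$ the order is $z_1,p_2,z_3,p_4,p_5,z_6$). *)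

theory Defs
  imports "HOL-Analysis.Analysis" "Jordan_Normal_Form.Determinant"
begin

text \<open>
  A point of complex $N$-space is an extensional function on \<open>{1..N}\<close>, so that indices are the
  1-based ones of the mathematics, replacing one coordinate is function update, and the
  index set is \<open>J = {1..n}\<close>.  The coefficient $b_j^m$ is \<open>b j m\<close>.
\<close>

abbreviation cspace :: "nat \<Rightarrow> (nat \<Rightarrow> complex) set" where
  "cspace N \<equiv> {1..N} \<rightarrow>\<^sub>E UNIV"

definition gfun :: "nat \<Rightarrow> (nat \<Rightarrow> nat \<Rightarrow> complex) \<Rightarrow> nat \<Rightarrow> (nat \<Rightarrow> complex) \<Rightarrow> complex" where
  "gfun k b j t = (\<Sum>m=1..k. b j m * t m)"

definition ffun ::
  "nat \<Rightarrow> (nat \<Rightarrow> nat \<Rightarrow> complex) \<Rightarrow> nat \<Rightarrow> (nat \<Rightarrow> complex) \<Rightarrow> (nat \<Rightarrow> complex) \<Rightarrow> complex" where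
  "ffun k b j z t = z j + gfun k b j t"

text \<open>
  \<open>dminor k b [i\<^sub>1, \<dots>, i\<^sub>k]\<close> is $d_{i_1,\dots,i_k}$; list positions and the rows and columns
  of \<^const>\<open>Matrix.mat\<close> are counted from 0, hence the shifts by one here and below.
\<close>

definition dminor :: "nat \<Rightarrow> (nat \<Rightarrow> nat \<Rightarrow> complex) \<Rightarrow> nat list \<Rightarrow> complex" where
  "dminor k b is = Determinant.det (Matrix.mat k k (\<lambda>(l, m). b (is ! l) (Suc m)))"

text \<open>The square does not depend on the order in which the elements of \<open>I\<close> are listed.\<close>

definition dsq :: "nat \<Rightarrow> (nat \<Rightarrow> nat \<Rightarrow> complex) \<Rightarrow> nat set \<Rightarrow> complex" where
  "dsq k b I = (dminor k b (sorted_list_of_set I))\<^sup>2"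

definition fcirc :: "nat \<Rightarrow> (nat \<Rightarrow> nat \<Rightarrow> complex) \<Rightarrow> nat list \<Rightarrow> (nat \<Rightarrow> complex) \<Rightarrow> complex" where
  "fcirc k b is z =
     (\<Sum>m=1..k+1. (-1) ^ (m - 1) * dminor k b (take (m - 1) is @ drop m is) * z (is ! (m - 1)))"

definition Delta :: "nat \<Rightarrow> nat \<Rightarrow> (nat \<Rightarrow> nat \<Rightarrow> complex) \<Rightarrow> (nat \<Rightarrow> complex) set" where
  "Delta n k b = {z \<in> cspace n.
     \<exists>is. length is = k + 1 \<and> sorted_wrt (<) is \<and> set is \<subseteq> {1..n} \<and> fcirc k b is z = 0}"

text \<open>
  The master function $\Phi = \sum_j a_j \log f_j$ is multivalued.  \<open>master n k b a z0 t0\<close> is the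
  branch of it near \<open>(z0, t0)\<close> (a point with all $f_j \neq 0$) in which $\log f_j$ is
  continued from the principal value at \<open>(z0, t0)\<close>; it is holomorphic there, even when
  $f_j$ takes a value on the cut of \<^const>\<open>Ln\<close>.  Branches differ by constants, so the first partial
  derivatives of $\Phi$ at \<open>(z0, t0)\<close> are those of this branch.
\<close>

definition master ::
  "nat \<Rightarrow> nat \<Rightarrow> (nat \<Rightarrow> nat \<Rightarrow> complex) \<Rightarrow> (nat \<Rightarrow> complex) \<Rightarrow> (nat \<Rightarrow> complex) \<Rightarrow> (nat \<Rightarrow> complex) \<Rightarrow>
   (nat \<Rightarrow> complex) \<Rightarrow> (nat \<Rightarrow> complex) \<Rightarrow> complex" where
  "master n k b a z0 t0 z t =
     (\<Sum>j=1..n. a j * (Ln (ffun k b j z0 t0) + Ln (ffun k b j z t / ffun k b j z0 t0)))"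

definition dPhi_dt ::
  "nat \<Rightarrow> nat \<Rightarrow> (nat \<Rightarrow> nat \<Rightarrow> complex) \<Rightarrow> (nat \<Rightarrow> complex) \<Rightarrow> nat \<Rightarrow>
   (nat \<Rightarrow> complex) \<Rightarrow> (nat \<Rightarrow> complex) \<Rightarrow> complex" where
  "dPhi_dt n k b a i z t = deriv (\<lambda>s. master n k b a z t z (t(i := s))) (t i)"

definition dPhi_dz ::
  "nat \<Rightarrow> nat \<Rightarrow> (nat \<Rightarrow> nat \<Rightarrow> complex) \<Rightarrow> (nat \<Rightarrow> complex) \<Rightarrow> nat \<Rightarrow>
   (nat \<Rightarrow> complex) \<Rightarrow> (nat \<Rightarrow> complex) \<Rightarrow> complex" where
  "dPhi_dz n k b a j z t = deriv (\<lambda>s. master n k b a z t (z(j := s)) t) (z j)"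

definition U0 ::
  "nat \<Rightarrow> nat \<Rightarrow> (nat \<Rightarrow> nat \<Rightarrow> complex) \<Rightarrow> ((nat \<Rightarrow> complex) \<times> (nat \<Rightarrow> complex)) set" where
  "U0 n k b = {(z, t) \<in> cspace n \<times> cspace k. z \<notin> Delta n k b \<and> (\<forall>j\<in>{1..n}. ffun k b j z t \<noteq> 0)}"

definition crit_set ::
  "nat \<Rightarrow> nat \<Rightarrow> (nat \<Rightarrow> nat \<Rightarrow> complex) \<Rightarrow> (nat \<Rightarrow> complex) \<Rightarrow>
   ((nat \<Rightarrow> complex) \<times> (nat \<Rightarrow> complex)) set" where
  "crit_set n k b a = {(z, t) \<in> U0 n k b. \<forall>i\<in>{1..k}. dPhi_dt n k b a i z t = 0}"

definition phi_map ::
  "nat \<Rightarrow> nat \<Rightarrow> (nat \<Rightarrow> nat \<Rightarrow> complex) \<Rightarrow> (nat \<Rightarrow> complex) \<Rightarrow>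
   (nat \<Rightarrow> complex) \<times> (nat \<Rightarrow> complex) \<Rightarrow> (nat \<Rightarrow> complex) \<times> (nat \<Rightarrow> complex)" where
  "phi_map n k b a = (\<lambda>(z, t). (z, \<lambda>j\<in>{1..n}. dPhi_dz n k b a j z t))"

definition Lam ::
  "nat \<Rightarrow> nat \<Rightarrow> (nat \<Rightarrow> nat \<Rightarrow> complex) \<Rightarrow> (nat \<Rightarrow> complex) \<Rightarrow>
   ((nat \<Rightarrow> complex) \<times> (nat \<Rightarrow> complex)) set" where
  "Lam n k b a = phi_map n k b a ` crit_set n k b a"

text \<open>The coordinates \<open>z\<^sub>i\<close> (\<open>i \<in> M\<close>) and \<open>p\<^sub>j\<close> (\<open>j \<notin> M\<close>), ordered by increasing index.\<close>

definition coords ::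
  "nat \<Rightarrow> nat set \<Rightarrow> (nat \<Rightarrow> complex) \<times> (nat \<Rightarrow> complex) \<Rightarrow> (nat \<Rightarrow> complex)" where
  "coords n M = (\<lambda>(z, p). \<lambda>j\<in>{1..n}. if j \<in> M then z j else p j)"

text \<open>
  The Jacobian at \<open>q\<close> of the projection \<open>(z, p) \<mapsto> z\<close> of \<open>X\<close>, with respect to the coordinates
  \<^term>\<open>coords n M\<close> on \<open>X\<close> and $z_1,\dots,z_n$ on the target: the projection is written in these
  coordinates by means of the inverse of \<^term>\<open>coords n M\<close> on \<open>X\<close>, and the \<open>(i, j)\<close> entry of the matrix is
  the holomorphic partial derivative of $z_i$ in the $j$-th coordinate at \<open>coords n M q\<close>.
  For \<open>X = \<Lambda>\<close> and \<open>M\<close> of size \<open>k\<close> the coordinates are injective on \<open>X\<close> with open image, so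
  the values of \<^const>\<open>inv_into\<close> off the image do not affect the derivatives.
\<close>

definition Jac ::
  "nat \<Rightarrow> ((nat \<Rightarrow> complex) \<times> (nat \<Rightarrow> complex)) set \<Rightarrow> nat set \<Rightarrow>
   (nat \<Rightarrow> complex) \<times> (nat \<Rightarrow> complex) \<Rightarrow> complex" where
  "Jac n X M q = Determinant.det (Matrix.mat n n (\<lambda>(i, j).
     deriv (\<lambda>s. fst (inv_into X (coords n M) ((coords n M q)(Suc j := s))) (Suc i))
           (coords n M q (Suc j))))"

end

theory Submission
  imports Defs
begin

text \<open>
  Put \<open>w\<^sub>j = a\<^sub>j / p\<^sub>j\<^sup>2\<close>.  On \<open>\<Lambda>\<close> there is a \<open>t\<close> with \<open>z\<^sub>j = a\<^sub>j / p\<^sub>j - g\<^sub>j(t)\<close>, and the equations of the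
  critical set say that \<open>\<Sum>\<^sub>j b\<^sub>j\<^sup>m p\<^sub>j = 0\<close> for all \<open>m\<close>.  Differentiating, \<open>W dp + B dt = - dz\<close> and
  \<open>B\<^sup>T dp = 0\<close>, where \<open>W\<close> is the diagonal matrix of the \<open>w\<^sub>j\<close> and \<open>B = (b\<^sub>j\<^sup>m)\<close>.  So the geometry is
  governed by the bordered matrix \<open>K = [[W, B], [B\<^sup>T, 0]]\<close> of size \<open>n + k\<close>, which does not know
  about \<open>M\<close>, and the formula comes from computing \<open>det K\<close> in two ways.

  First, \<open>det K\<close> is of degree at most one in each \<open>w\<^sub>j\<close>, and the coefficient of
  \<open>\<Prod>\<^sub>j\<^sub>\<in>\<^sub>L w\<^sub>j\<close> is the principal minor of \<open>[[0, B], [B\<^sup>T, 0]]\<close> left after deleting \<open>L\<close>.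
  That minor is zero unless \<open>J - L\<close> has \<open>k\<close> elements, when it is \<open>(-1)\<^sup>k\<close> times the
  square of the corresponding minor of \<open>B\<close>.  Hence \<open>(-1)\<^sup>k det K\<close> is the sum of the theorem
  (\<open>set_det_bordered_expansion\<close>).

  Second, for a \<open>k\<close>-element set \<open>M\<close> write \<open>b\<^sub>i = \<Sum>\<^sub>h\<^sub>\<in>\<^sub>M C\<^sub>i\<^sub>h b\<^sub>h\<close>.  The block of \<open>K\<close> on \<open>M\<close> and the
  border has determinant \<open>(-1)\<^sup>k d\<^sub>M\<^sup>2\<close>, and its Schur complement is the matrix
  \<open>N\<^sub>i\<^sub>l = \<delta>\<^sub>i\<^sub>l w\<^sub>i + \<Sum>\<^sub>h\<^sub>\<in>\<^sub>M C\<^sub>i\<^sub>h w\<^sub>h C\<^sub>l\<^sub>h\<close> on \<open>J - M\<close>, so that \<open>det K = (-1)\<^sup>k d\<^sub>M\<^sup>2 det N\<close>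
  (\<open>set_det_bordered_schur\<close>).

  Finally, eliminating \<open>t\<close> and \<open>p\<^sub>M\<close> gives
  \<open>z\<^sub>i = a\<^sub>i / p\<^sub>i - \<Sum>\<^sub>h\<^sub>\<in>\<^sub>M C\<^sub>i\<^sub>h (a\<^sub>h / p\<^sub>h - z\<^sub>h)\<close> and \<open>p\<^sub>h = - \<Sum>\<^sub>l\<^sub>\<notin>\<^sub>M C\<^sub>l\<^sub>h p\<^sub>l\<close> for \<open>i \<notin> M\<close>, \<open>h \<in> M\<close>.
  In these coordinates the Jacobian matrix of \<open>(z, p) \<mapsto> z\<close> is block triangular, with the
  identity on \<open>M\<close> and \<open>- N\<close> on \<open>J - M\<close>; so \<open>Jac\<^sub>M = (-1)\<^sup>n\<^sup>-\<^sup>k det N\<close> (\<open>Jac_eq_schur\<close>).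
\<close>

section \<open>Determinants indexed by finite sets\<close>

text \<open>
  The determinants below live on subsets of \<open>J\<close> and on sets such as \<open>M\<close> together with the border.
  Indexing rows and columns by the set itself avoids choosing an order: simultaneous
  permutation of rows and columns does not change the determinant.
\<close>

definition set_det :: "'i set \<Rightarrow> ('i \<Rightarrow> 'i \<Rightarrow> 'a::comm_ring_1) \<Rightarrow> 'a" where
  "set_det S f = (\<Sum>p | p permutes S. of_int (sign p) * (\<Prod>i\<in>S. f i (p i)))"

lemma set_det_cong:
  assumes "\<And>i j. i \<in> S \<Longrightarrow> j \<in> S \<Longrightarrow> f i j = g i j"
  shows "set_det S f = set_det S g"
  unfolding set_det_def
  by (intro sum.cong refl arg_cong2[of _ _ _ _ "(*)"] prod.cong)
     (auto intro: assms simp: permutes_in_image)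

lemma set_det_reindex:
  assumes "bij_betw h A S" and "finite A"
  shows "set_det S f = set_det A (\<lambda>i j. f (h i) (h j))"
proof -
  have inj: "inj_on h A" and S: "S = h ` A"
    using assms(1) by (auto simp: bij_betw_def)
  have bij': "bij_betw (inv_into A h) S A"
    using assms(1) by (rule bij_betw_inv_into)
  have finS: "finite S" using S assms(2) by simp
  have "(\<Sum>p | p permutes S. of_int (sign p) * (\<Prod>i\<in>S. f i (p i))) =
        (\<Sum>p | p permutes A. of_int (sign p) * (\<Prod>i\<in>A. f (h i) (h (p i))))"
  proof (rule sum.reindex_bij_witness[of _ "map_permutation A h" "map_permutation S (inv_into A h)"])
    fix p assume "p \<in> {p. p permutes S}"
    then have p: "p permutes S" by simp
    show "map_permutation A h (map_permutation S (inv_into A h) p) = p"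
      by (rule map_permutation_compose_inv[OF bij' p]) (use S in \<open>auto simp: f_inv_into_f\<close>)
    show "map_permutation S (inv_into A h) p \<in> {p. p permutes A}"
      using map_permutation_permutes[OF bij' p] by simp
    have sg: "sign (map_permutation S (inv_into A h) p) = sign p"
      by (rule sign_map_permutation) (use p finS bij' in \<open>auto simp: bij_betw_def\<close>)
    have "(\<Prod>i\<in>S. f i (p i)) =
          (\<Prod>i\<in>A. f (h i) (h (map_permutation S (inv_into A h) p i)))"
      unfolding S prod.reindex[OF inj] o_def
    proof (rule prod.cong[OF refl])
      fix i assume i: "i \<in> A"
      have "map_permutation S (inv_into A h) p (inv_into A h (h i)) = inv_into A h (p (h i))"
        by (rule map_permutation_apply) (use bij' i S in \<open>auto simp: bij_betw_def\<close>)
      moreover have "p (h i) \<in> h ` A"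
        using p i S by (auto simp: permutes_in_image)
      ultimately show "f (h i) (p (h i)) = f (h i) (h (map_permutation (h ` A) (inv_into A h) p i))"
        using i inj S by (simp add: f_inv_into_f)
    qed
    then show "of_int (sign (map_permutation S (inv_into A h) p)) *
        (\<Prod>i\<in>A. f (h i) (h (map_permutation S (inv_into A h) p i))) =
        of_int (sign p) * (\<Prod>i\<in>S. f i (p i))"
      by (simp add: sg)
  next
    fix p assume "p \<in> {p. p permutes A}"
    then have p: "p permutes A" by simp
    show "map_permutation S (inv_into A h) (map_permutation A h p) = p"
      by (rule map_permutation_compose_inv[OF assms(1) p]) (use inj in auto)
    show "map_permutation A h p \<in> {p. p permutes S}"
      using map_permutation_permutes[OF assms(1) p] by simp
  qed
  then show ?thesis by (simp add: set_det_def)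
qed

lemma det_eq_set_det:
  "Determinant.det (Matrix.mat n n (\<lambda>(i, j). f i j)) = set_det {0..<n} f"
proof -
  have "p i < n" if "p permutes {0..<n}" "i < n" for p i
    using permutes_in_image[OF that(1), of i] that(2) by simp
  then show ?thesis
    by (subst det_def'[of _ n]) (auto simp: set_det_def intro!: sum.cong prod.cong)
qed

text \<open>
  Any enumeration of the set turns its determinant into one of an ordinary matrix; this
  transfers the product rule and the block formulas.
\<close>

lemma set_det_list:
  assumes "distinct xs"
  shows "set_det (set xs) f =
    Determinant.det (Matrix.mat (length xs) (length xs) (\<lambda>(i, j). f (xs ! i) (xs ! j)))"
  unfolding det_eq_set_det
  by (rule set_det_reindex) (use assms bij_betw_nth[OF assms] in \<open>auto simp: atLeast0LessThan\<close>)

lemma set_det_mult: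
  assumes "finite S"
  shows "set_det S (\<lambda>i j. \<Sum>h\<in>S. f i h * g h j) = set_det S f * set_det S g"
proof -
  obtain xs where xs: "distinct xs" "set xs = S"
    using finite_distinct_list[OF assms] by blast
  let ?n = "length xs"
  let ?m = "\<lambda>f. Matrix.mat ?n ?n (\<lambda>(i, j). f (xs ! i) (xs ! j))"
  have "(\<Sum>h\<in>S. f (xs ! i) h * g h (xs ! j)) =
        (\<Sum>l = 0..<?n. f (xs ! i) (xs ! l) * g (xs ! l) (xs ! j))" for i j
    using sum.reindex_bij_betw[OF bij_betw_nth[OF xs(1) refl refl], of "\<lambda>h. f (xs ! i) h * g h (xs ! j)"]
    by (simp add: xs(2) atLeast0LessThan)
  then have "?m (\<lambda>i j. \<Sum>h\<in>S. f i h * g h j) = ?m f * ?m g"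
    by (intro eq_matI) (auto simp: scalar_prod_def)
  then show ?thesis
    unfolding xs(2)[symmetric] set_det_list[OF xs(1)]
    by (metis (no_types, lifting) det_mult mat_carrier)
qed

lemma set_det_triangular:
  fixes f :: "'i \<Rightarrow> 'i \<Rightarrow> 'a::idom"
  assumes "finite A" "finite B" "A \<inter> B = {}"
    and zero: "\<And>a b. a \<in> A \<Longrightarrow> b \<in> B \<Longrightarrow> f a b = 0"
  shows "set_det (A \<union> B) f = set_det A f * set_det B f"
proof -
  obtain xs where xs: "distinct xs" "set xs = A"
    using finite_distinct_list[OF assms(1)] by blast
  obtain ys where ys: "distinct ys" "set ys = B"
    using finite_distinct_list[OF assms(2)] by blast
  have d: "distinct (xs @ ys)" "set (xs @ ys) = A \<union> B"
    using xs ys assms(3) by auto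
  let ?n = "length xs" and ?m = "length ys"
  let ?A1 = "Matrix.mat ?n ?n (\<lambda>(i, j). f (xs ! i) (xs ! j))"
  let ?A3 = "Matrix.mat ?m ?n (\<lambda>(i, j). f (ys ! i) (xs ! j))"
  let ?A4 = "Matrix.mat ?m ?m (\<lambda>(i, j). f (ys ! i) (ys ! j))"
  have "Matrix.mat (length (xs @ ys)) (length (xs @ ys)) (\<lambda>(i, j). f ((xs @ ys) ! i) ((xs @ ys) ! j))
      = four_block_mat ?A1 (0\<^sub>m ?n ?m) ?A3 ?A4"
    by (intro eq_matI) (auto simp: nth_append zero xs(2)[symmetric] ys(2)[symmetric])
  then have "set_det (A \<union> B) f = Determinant.det (four_block_mat ?A1 (0\<^sub>m ?n ?m) ?A3 ?A4)"
    using set_det_list[OF d(1), of f] d(2) by simp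
  also have "\<dots> = Determinant.det ?A1 * Determinant.det ?A4"
    by (rule det_four_block_mat_upper_right_zero) auto
  finally show ?thesis
    using set_det_list[OF xs(1), of f] set_det_list[OF ys(1), of f] xs(2) ys(2) by simp
qed

lemma set_det_diagonal:
  assumes "finite S" and "\<And>i j. i \<in> S \<Longrightarrow> j \<in> S \<Longrightarrow> f i j = (if i = j then w i else 0)"
  shows "set_det S f = (\<Prod>i\<in>S. w i)"
proof -
  have "(\<Prod>i\<in>S. f i (p i)) = 0" if p: "p permutes S" and "p \<noteq> id" for p
  proof -
    obtain i where i: "p i \<noteq> i" using \<open>p \<noteq> id\<close> by (metis eq_id_iff)
    then have "i \<in> S" using p permutes_not_in by fastforce
    moreover have "p i \<in> S" using p \<open>i \<in> S\<close> by (simp add: permutes_in_image)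
    ultimately show ?thesis using assms i by (intro prod_zero) force+
  qed
  then have "set_det S f = (\<Sum>p\<in>{id}. of_int (sign p) * (\<Prod>i\<in>S. f i (p i)))"
    unfolding set_det_def using assms(1)
    by (intro sum.mono_neutral_right) (auto simp: finite_permutations permutes_id)
  then show ?thesis using assms(2) by (simp add: sign_id)
qed

text \<open>
  By row linearity, each diagonal perturbation \<open>w i\<close> is either taken, which replaces row \<open>i\<close> by
  \<open>w i\<close> times a unit vector and so deletes row and column \<open>i\<close>, or not taken.
\<close>

lemma set_det_add_diagonal:
  fixes f :: "'i \<Rightarrow> 'i \<Rightarrow> 'a::idom"
  assumes "finite S"
  shows "set_det S (\<lambda>i j. f i j + (if i = j then w i else 0)) =
    (\<Sum>L\<in>Pow S. (\<Prod>i\<in>L. w i) * set_det (S - L) f)"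
proof -
  \<comment> \<open>the rows in \<open>L\<close> are replaced by unit vectors\<close>
  let ?g = "\<lambda>L i j. if i \<in> L then (if i = j then 1 else 0) else f i j"
  have prods: "(\<Prod>i\<in>L. if i = p i then w i else 0) * (\<Prod>i\<in>S - L. f i (p i)) =
      (\<Prod>i\<in>L. w i) * (\<Prod>i\<in>S. ?g L i (p i))" if "L \<subseteq> S" for L p
  proof -
    have finL: "finite L" using assms that finite_subset by blast
    have "(\<Prod>i\<in>S. ?g L i (p i)) = (\<Prod>i\<in>L. ?g L i (p i)) * (\<Prod>i\<in>S - L. ?g L i (p i))"
      using prod.subset_diff[OF that assms, of "\<lambda>i. ?g L i (p i)"] by (simp add: mult.commute)
    also have "(\<Prod>i\<in>S - L. ?g L i (p i)) = (\<Prod>i\<in>S - L. f i (p i))"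
      by (intro prod.cong) auto
    also have "(\<Prod>i\<in>L. ?g L i (p i)) = (\<Prod>i\<in>L. if i = p i then 1 else 0)"
      by (intro prod.cong) auto
    finally show ?thesis
      by (simp add: prod.distrib[symmetric] mult.assoc[symmetric] if_distrib cong: if_cong)
  qed
  have dets: "set_det S (?g L) = set_det (S - L) f" if "L \<subseteq> S" for L
  proof -
    have finL: "finite L" using assms that finite_subset by blast
    have "set_det (L \<union> (S - L)) (?g L) = set_det L (?g L) * set_det (S - L) (?g L)"
      by (rule set_det_triangular) (use finL assms in auto)
    also have "set_det L (?g L) = 1"
      by (subst set_det_diagonal[where w = "\<lambda>_. 1"]) (use finL in auto)
    also have "set_det (S - L) (?g L) = set_det (S - L) f"
      by (rule set_det_cong) auto
    finally show ?thesis using that by (simp add: Un_absorb1)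
  qed
  have "set_det S (\<lambda>i j. f i j + (if i = j then w i else 0)) =
    (\<Sum>p | p permutes S. \<Sum>L\<in>Pow S. of_int (sign p) * ((\<Prod>i\<in>L. w i) * (\<Prod>i\<in>S. ?g L i (p i))))"
    unfolding set_det_def
  proof (rule sum.cong[OF refl])
    fix p
    have "(\<Prod>i\<in>S. f i (p i) + (if i = p i then w i else 0)) =
        (\<Sum>L\<in>Pow S. (\<Prod>i\<in>L. if i = p i then w i else 0) * (\<Prod>i\<in>S - L. f i (p i)))"
      by (subst add.commute) (rule prod_add[OF assms])
    also have "\<dots> = (\<Sum>L\<in>Pow S. (\<Prod>i\<in>L. w i) * (\<Prod>i\<in>S. ?g L i (p i)))"
      by (rule sum.cong[OF refl], rule prods) auto
    finally show "of_int (sign p) * (\<Prod>i\<in>S. f i (p i) + (if i = p i then w i else 0)) =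
      (\<Sum>L\<in>Pow S. of_int (sign p) * ((\<Prod>i\<in>L. w i) * (\<Prod>i\<in>S. ?g L i (p i))))"
      by (simp add: sum_distrib_left)
  qed
  also have "\<dots> = (\<Sum>L\<in>Pow S. (\<Prod>i\<in>L. w i) * set_det S (?g L))"
    unfolding set_det_def
    by (subst sum.swap) (simp add: sum_distrib_left mult.left_commute)
  also have "\<dots> = (\<Sum>L\<in>Pow S. (\<Prod>i\<in>L. w i) * set_det (S - L) f)"
    by (rule sum.cong[OF refl]) (use dets in auto)
  finally show ?thesis .
qed

lemma set_det_uminus:
  assumes "finite S"
  shows "set_det S (\<lambda>i j. - f i j) = (-1) ^ card S * set_det S f"
proof -
  have "(\<Prod>i\<in>S. - f i (p i)) = (-1) ^ card S * (\<Prod>i\<in>S. f i (p i))" for p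
    using assms by (simp add: prod_uminus)
  then show ?thesis
    by (simp add: set_det_def sum_distrib_left mult.left_commute)
qed

section \<open>The bordered matrix and its expansion\<close>

text \<open>
  The symmetric matrix \<open>[[W, B], [B\<^sup>T, 0]]\<close> with \<open>W\<close> diagonal: \<open>Inl\<close> marks the indices
  \<open>j \<in> J\<close>, and \<open>Inr\<close> marks the border indices \<open>1, \<dots>, k\<close>.
\<close>

definition bordered ::
  "(nat \<Rightarrow> complex) \<Rightarrow> (nat \<Rightarrow> nat \<Rightarrow> complex) \<Rightarrow> nat + nat \<Rightarrow> nat + nat \<Rightarrow> complex" where
  "bordered w b x y = (case (x, y) of
     (Inl i, Inl j) \<Rightarrow> (if i = j then w i else 0)
   | (Inl i, Inr m) \<Rightarrow> b i m
   | (Inr m, Inl j) \<Rightarrow> b j m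
   | (Inr _, Inr _) \<Rightarrow> 0)"

lemma bordered_simps [simp]:
  "bordered w b (Inl i) (Inl j) = (if i = j then w i else 0)"
  "bordered w b (Inl i) (Inr m) = b i m"
  "bordered w b (Inr m) (Inl j) = b j m"
  "bordered w b (Inr m) (Inr m') = 0"
  by (simp_all add: bordered_def)

text \<open>
  For square \<open>B\<close> the lower right block, being zero, commutes with \<open>B\<^sup>T\<close>, so the determinant is
  \<open>det (W 0 - B B\<^sup>T) = det (- B B\<^sup>T)\<close>.
\<close>

lemma set_det_bordered_square:
  assumes "finite R" "card R = k"
  shows "set_det (R <+> {1..k}) (bordered w b) = (-1) ^ k * dsq k b R"
proof -
  define xs where "xs = sorted_list_of_set R"
  have xs: "distinct xs" "set xs = R" "length xs = k"
    using assms by (auto simp: xs_def)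
  define zs :: "(nat + nat) list" where "zs = map Inl xs @ map Inr [1..<Suc k]"
  have zs: "distinct zs" "set zs = R <+> {1..k}" "length zs = k + k"
    using xs by (auto simp: zs_def distinct_map Plus_def atLeastLessThanSuc_atLeastAtMost simp del: upt_Suc)
  let ?D = "Matrix.mat k k (\<lambda>(l, l'). bordered w b (Inl (xs ! l)) (Inl (xs ! l')))"
  let ?B = "Matrix.mat k k (\<lambda>(l, m). b (xs ! l) (Suc m))"
  have carr: "?D \<in> carrier_mat k k" "?B \<in> carrier_mat k k"
    "transpose_mat ?B \<in> carrier_mat k k" "0\<^sub>m k k \<in> carrier_mat k k"
    by auto
  have "Matrix.mat (length zs) (length zs) (\<lambda>(i, j). bordered w b (zs ! i) (zs ! j))
      = four_block_mat ?D ?B (transpose_mat ?B) (0\<^sub>m k k)"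
    by (intro eq_matI) (auto simp: zs_def nth_append xs(3) simp del: upt_Suc)
  then have "set_det (R <+> {1..k}) (bordered w b) =
      Determinant.det (four_block_mat ?D ?B (transpose_mat ?B) (0\<^sub>m k k))"
    using set_det_list[OF zs(1), of "bordered w b"] zs(2) by simp
  also have "\<dots> = Determinant.det (?D * 0\<^sub>m k k - ?B * transpose_mat ?B)"
    by (rule det_four_block_mat) auto
  also have "?D * 0\<^sub>m k k - ?B * transpose_mat ?B = (-1) \<cdot>\<^sub>m (?B * transpose_mat ?B)"
    by (intro eq_matI) auto
  also have "Determinant.det \<dots> = (-1) ^ k * (Determinant.det ?B * Determinant.det (transpose_mat ?B))"
    by (simp only: det_smult det_mult[OF carr(2,3)]) simp
  also have "Determinant.det (transpose_mat ?B) = Determinant.det ?B"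
    by (rule det_transpose[OF carr(2)])
  finally show ?thesis
    by (simp add: dsq_def dminor_def xs_def power2_eq_square)
qed

text \<open>
  A permutation that contributes to the determinant has to exchange \<open>R\<close> with the border, which
  requires equal cardinalities.
\<close>

lemma set_det_bordered_nonsquare:
  assumes "finite R" "card R \<noteq> k"
  shows "set_det (R <+> {1..k}) (bordered (\<lambda>_. 0) b) = 0"
  unfolding set_det_def
proof (rule sum.neutral, intro ballI)
  let ?S = "R <+> {1..k}"
  fix p assume "p \<in> {p. p permutes ?S}"
  then have p: "p permutes ?S" by simp
  have finS: "finite ?S" using assms(1) by simp
  have "\<exists>x\<in>?S. bordered (\<lambda>_. 0) b x (p x) = 0"
  proof (rule ccontr)
    assume "\<not> ?thesis"
    then have nz: "bordered (\<lambda>_. 0) b x (p x) \<noteq> 0" if "x \<in> ?S" for x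
      using that by blast
    have pS: "p x \<in> ?S" if "x \<in> ?S" for x
      using p that by (simp add: permutes_in_image)
    have "p ` Inl ` R \<subseteq> Inr ` {1..k}"
    proof safe
      fix i assume i: "i \<in> R"
      then have "(Inl i :: nat + nat) \<in> ?S" by blast
      with nz[of "Inl i"] pS[of "Inl i"] show "p (Inl i) \<in> Inr ` {1..k}"
        by (cases "p (Inl i)") (auto split: if_splits)
    qed
    moreover have "p ` Inr ` {1..k} \<subseteq> Inl ` R"
    proof safe
      fix m assume m: "m \<in> {1..k}"
      then have "(Inr m :: nat + nat) \<in> ?S" by blast
      with nz[of "Inr m"] pS[of "Inr m"] show "p (Inr m) \<in> Inl ` R"
        by (cases "p (Inr m)") auto
    qed
    moreover have "card (p ` X) = card X" for X
      by (rule card_image) (use p in \<open>auto intro: inj_on_subset dest: permutes_inj\<close>)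
    ultimately have "card R \<le> k" "k \<le> card R"
      using card_mono[of "Inr ` {1..k} :: (nat + nat) set" "p ` Inl ` R"]
        card_mono[of "Inl ` R :: (nat + nat) set" "p ` Inr ` {1..k}"] assms(1)
      by (simp_all add: card_image)
    then show False using assms(2) by simp
  qed
  then show "of_int (sign p) * (\<Prod>x\<in>?S. bordered (\<lambda>_. 0) b x (p x)) = 0"
    using finS by simp
qed

text \<open>
  The expansion in the diagonal entries; the two preceding lemmas evaluate the principal minors
  of \<open>[[0, B], [B\<^sup>T, 0]]\<close> that occur as coefficients.
\<close>

lemma set_det_bordered_expansion:
  assumes "finite J" "k \<le> card J"
  shows "set_det (J <+> {1..k}) (bordered w b) =
    (-1) ^ k * (\<Sum>L | L \<subseteq> J \<and> card L = card J - k. dsq k b (J - L) * (\<Prod>j\<in>L. w j))"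
proof -
  let ?S = "J <+> {1..k}"
  let ?v = "case_sum w (\<lambda>_. 0)"
  let ?f = "bordered (\<lambda>_. 0) b"
  let ?term = "\<lambda>L. (\<Prod>x\<in>L. ?v x) * set_det (?S - L) ?f"
  have finS: "finite ?S" using assms(1) by simp
  have "set_det ?S (bordered w b) = set_det ?S (\<lambda>x y. ?f x y + (if x = y then ?v x else 0))"
    by (rule set_det_cong) (auto simp: Plus_def split: if_splits)
  also have "\<dots> = (\<Sum>L\<in>Pow ?S. ?term L)"
    by (rule set_det_add_diagonal[OF finS])
  \<comment> \<open>the diagonal vanishes on the border, so only subsets of \<open>J\<close> contribute\<close>
  also have "\<dots> = (\<Sum>L\<in>(`) Inl ` Pow J. ?term L)"
  proof (rule sum.mono_neutral_right)
    show "\<forall>L\<in>Pow ?S - (`) Inl ` Pow J. ?term L = 0"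
    proof
      fix L assume L: "L \<in> Pow ?S - (`) Inl ` Pow J"
      have "\<exists>m. Inr m \<in> L"
      proof (rule ccontr)
        assume "\<not> ?thesis"
        then have "L = Inl ` (Inl -` L)" "Inl -` L \<subseteq> J"
          using L by (auto simp: Plus_def image_iff)
        then show False using L by blast
      qed
      moreover have "finite L" using L finS finite_subset by blast
      ultimately have "(\<Prod>x\<in>L. ?v x) = 0" by (intro prod_zero) force+
      then show "?term L = 0" by simp
    qed
  qed (use finS in \<open>auto simp: Plus_def\<close>)
  also have "\<dots> = (\<Sum>L\<in>Pow J. ?term (Inl ` L))"
    by (subst sum.reindex) (auto simp: inj_on_def)
  also have "\<dots> = (\<Sum>L\<in>Pow J. (\<Prod>j\<in>L. w j) * set_det ((J - L) <+> {1..k}) ?f)"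
  proof (rule sum.cong[OF refl])
    fix L assume "L \<in> Pow J"
    moreover have "?S - Inl ` L = (J - L) <+> {1..k}" by (auto simp: Plus_def)
    ultimately show "?term (Inl ` L) = (\<Prod>j\<in>L. w j) * set_det ((J - L) <+> {1..k}) ?f"
      by (simp add: prod.reindex)
  qed
  also have "\<dots> = (\<Sum>L | L \<subseteq> J \<and> card L = card J - k.
      (\<Prod>j\<in>L. w j) * set_det ((J - L) <+> {1..k}) ?f)"
  proof (rule sum.mono_neutral_right)
    show "\<forall>L\<in>Pow J - {L. L \<subseteq> J \<and> card L = card J - k}.
        (\<Prod>j\<in>L. w j) * set_det ((J - L) <+> {1..k}) ?f = 0"
    proof
      fix L assume L: "L \<in> Pow J - {L. L \<subseteq> J \<and> card L = card J - k}"
      then have "card (J - L) = card J - card L" "card L \<le> card J"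
        using assms(1) by (auto simp: card_Diff_subset finite_subset card_mono)
      then have "card (J - L) \<noteq> k" using L by auto
      then show "(\<Prod>j\<in>L. w j) * set_det ((J - L) <+> {1..k}) ?f = 0"
        using set_det_bordered_nonsquare[of "J - L"] assms(1) by simp
    qed
  qed (use assms(1) in auto)
  also have "\<dots> = (\<Sum>L | L \<subseteq> J \<and> card L = card J - k.
      (-1) ^ k * (dsq k b (J - L) * (\<Prod>j\<in>L. w j)))"
  proof (rule sum.cong[OF refl])
    fix L assume L: "L \<in> {L. L \<subseteq> J \<and> card L = card J - k}"
    then have "card (J - L) = k"
      using assms by (auto simp: card_Diff_subset finite_subset)
    then show "(\<Prod>j\<in>L. w j) * set_det ((J - L) <+> {1..k}) ?f =
        (-1) ^ k * (dsq k b (J - L) * (\<Prod>j\<in>L. w j))"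
      using set_det_bordered_square[of "J - L" k "\<lambda>_. 0" b] assms(1) by simp
  qed
  finally show ?thesis by (simp add: sum_distrib_left)
qed

section \<open>The Schur complement attached to a set of rows\<close>

lemma dminor_inverse:
  assumes "finite M" "card M = k" "dminor k b (sorted_list_of_set M) \<noteq> 0"
  shows "\<exists>V.
    (\<forall>i\<in>M. \<forall>h\<in>M. (\<Sum>m=1..k. b i m * V m h) = (if i = h then 1 else 0)) \<and>
    (\<forall>m\<in>{1..k}. \<forall>m'\<in>{1..k}. (\<Sum>i\<in>M. V m i * b i m') = (if m = m' then 1 else 0))"
proof -
  define xs where "xs = sorted_list_of_set M"
  have xs: "distinct xs" "set xs = M" "length xs = k"
    using assms by (auto simp: xs_def)
  let ?B = "Matrix.mat k k (\<lambda>(l, m). b (xs ! l) (Suc m))"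
  have B: "?B \<in> carrier_mat k k" by simp
  have "Determinant.det ?B \<noteq> 0"
    using assms(3) by (simp add: dminor_def xs_def)
  from det_non_zero_imp_unit[OF B this, unfolded Units_def, of "()"]
  obtain C where C: "C \<in> carrier_mat k k" and CB: "C * ?B = 1\<^sub>m k" and BC: "?B * C = 1\<^sub>m k"
    by (auto simp: ring_mat_def)
  have bij: "bij_betw ((!) xs) {0..<k} M"
    using bij_betw_nth[OF xs(1) refl refl] xs(2,3) by (simp add: atLeast0LessThan)
  \<comment> \<open>the position of an element of \<open>M\<close> in the increasing enumeration\<close>
  define pos where "pos = inv_into {0..<k} ((!) xs)"
  have pos: "pos i < k" "xs ! pos i = i" if "i \<in> M" for i
    using bij_betw_inv_into_right[OF bij that] bij_betwE[OF bij_betw_inv_into[OF bij]] that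
    by (auto simp: pos_def)
  have pos_nth: "pos (xs ! l) = l" if "l < k" for l
    using bij_betw_inv_into_left[OF bij, of l] that by (simp add: pos_def)
  define V where "V m i = C $$ (m - 1, pos i)" for m i
  show ?thesis
  proof (intro exI[of _ V] conjI ballI)
    fix i h assume ih: "i \<in> M" "h \<in> M"
    have "(\<Sum>m=1..k. b i m * V m h) = (\<Sum>m=0..<k. b i (Suc m) * V (Suc m) h)"
      by (rule sum.reindex_bij_witness[of _ Suc "\<lambda>m. m - 1"]) auto
    also have "\<dots> = (?B * C) $$ (pos i, pos h)"
      using pos[OF ih(1)] pos[OF ih(2)] C by (auto simp: scalar_prod_def V_def)
    also have "\<dots> = (if i = h then 1 else 0)"
    proof -
      have "pos i = pos h \<longleftrightarrow> i = h" using pos(2)[OF ih(1)] pos(2)[OF ih(2)] by metis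
      then show ?thesis unfolding BC using pos(1)[OF ih(1)] pos(1)[OF ih(2)] by simp
    qed
    finally show "(\<Sum>m=1..k. b i m * V m h) = (if i = h then 1 else 0)" .
  next
    fix m m' assume mm: "m \<in> {1..k}" "m' \<in> {1..k}"
    have "(\<Sum>i\<in>M. V m i * b i m') = (\<Sum>l=0..<k. V m (xs ! l) * b (xs ! l) m')"
      by (rule sum.reindex_bij_betw[OF bij, symmetric])
    also have "\<dots> = (C * ?B) $$ (m - 1, m' - 1)"
      using mm C by (auto simp: scalar_prod_def V_def pos_nth)
    also have "\<dots> = (if m = m' then 1 else 0)"
      unfolding CB using mm by auto
    finally show "(\<Sum>i\<in>M. V m i * b i m') = (if m = m' then 1 else 0)" .
  qed
qed

text \<open>
  The data of the coordinates attached to \<open>M\<close>: the matrix \<open>V\<close> is the inverse of the square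
  matrix formed by the rows \<open>b\<^sub>i\<close>, \<open>i \<in> M\<close>.
\<close>

locale complementary_chart =
  fixes n k :: nat and b :: "nat \<Rightarrow> nat \<Rightarrow> complex" and a :: "nat \<Rightarrow> complex"
    and M :: "nat set" and V :: "nat \<Rightarrow> nat \<Rightarrow> complex"
  assumes M_subset: "M \<subseteq> {1..n}" and card_M: "card M = k"
    and a_nonzero: "\<forall>j\<in>{1..n}. a j \<noteq> 0"
    and b_V: "\<And>i h. i \<in> M \<Longrightarrow> h \<in> M \<Longrightarrow> (\<Sum>m=1..k. b i m * V m h) = (if i = h then 1 else 0)"
    and V_b: "\<And>m m'. m \<in> {1..k} \<Longrightarrow> m' \<in> {1..k} \<Longrightarrow>
      (\<Sum>i\<in>M. V m i * b i m') = (if m = m' then 1 else 0)"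
begin

text \<open>
  The row \<open>b\<^sub>i\<close> expanded in the basis of the rows \<open>b\<^sub>h\<close>, \<open>h \<in> M\<close>; see \<open>b_eq_C_b\<close>.
\<close>

definition C :: "nat \<Rightarrow> nat \<Rightarrow> complex" where
  "C i h = (\<Sum>m=1..k. b i m * V m h)"

lemma finite_M: "finite M"
  using M_subset finite_subset by blast

lemma C_M: "i \<in> M \<Longrightarrow> h \<in> M \<Longrightarrow> C i h = (if i = h then 1 else 0)"
  unfolding C_def by (rule b_V)

lemma b_eq_C_b:
  assumes "m \<in> {1..k}"
  shows "(\<Sum>h\<in>M. C i h * b h m) = b i m"
proof -
  have "(\<Sum>h\<in>M. C i h * b h m) = (\<Sum>m'=1..k. b i m' * (\<Sum>h\<in>M. V m' h * b h m))"
    unfolding C_def sum_distrib_left sum_distrib_right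
    by (subst sum.swap) (simp add: mult.assoc)
  also have "\<dots> = (\<Sum>m'=1..k. b i m' * (if m' = m then 1 else 0))"
    by (intro sum.cong refl arg_cong2[of _ _ _ _ "(*)"] V_b assms) auto
  also have "\<dots> = b i m" using assms by (simp add: if_distrib cong: if_cong)
  finally show ?thesis .
qed

text \<open>
  The Schur complement, on \<open>J - M\<close>, of the block of \<^term>\<open>bordered w b\<close> on \<open>M\<close> and the border.
\<close>

definition schur :: "(nat \<Rightarrow> complex) \<Rightarrow> nat \<Rightarrow> nat \<Rightarrow> complex" where
  "schur w i l = (if i = l then w i else 0) + (\<Sum>h\<in>M. C i h * w h * C l h)"

text \<open>
  Block elimination: multiplying by a unitriangular matrix \<open>Q\<close> clears the block above the
  Schur complement and does not change the determinant.
\<close>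

lemma set_det_bordered_schur:
  "set_det ({1..n} <+> {1..k}) (bordered w b) =
     (-1) ^ k * dsq k b M * set_det ({1..n} - M) (schur w)"
proof -
  define A where "A = M <+> {1..k}"
  define B where "B = (Inl ` ({1..n} - M) :: (nat + nat) set)"
  define S where "S = A \<union> B"
  \<comment> \<open>On \<open>A \<times> B\<close> the matrix \<open>Q\<close> is \<open>- K\<^sub>A\<^sub>A\<^sup>-\<^sup>1 K\<^sub>A\<^sub>B\<close>, where the inverse of \<open>[[W, X], [X\<^sup>T, 0]]\<close> is\<close>
  \<comment> \<open>\<open>[[0, V\<^sup>T], [V, - V W V\<^sup>T]]\<close> for \<open>V = X\<^sup>-\<^sup>1\<close>.\<close>
  define Q :: "nat + nat \<Rightarrow> nat + nat \<Rightarrow> complex" where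
    "Q x y = (if y \<in> B
       then (case x of
           Inl i \<Rightarrow> (if i \<in> M then - C (projl y) i else if x = y then 1 else 0)
         | Inr m \<Rightarrow> (\<Sum>h\<in>M. V m h * w h * C (projl y) h))
       else if x = y then 1 else 0)" for x y
  let ?K = "bordered w b"
  let ?KQ = "\<lambda>x y. \<Sum>h\<in>S. ?K x h * Q h y"
  have fin: "finite A" "finite B" "finite S" and disj: "A \<inter> B = {}"
    using finite_M by (auto simp: A_def B_def S_def)
  have S_eq: "S = {1..n} <+> {1..k}"
    using M_subset by (auto simp: S_def A_def B_def)
  have KQ_A: "?KQ x y = ?K x y" if "y \<in> A" for x y
  proof -
    have "y \<notin> B" "y \<in> S" using that disj by (auto simp: S_def)
    then have "?KQ x y = (\<Sum>h\<in>S. if h = y then ?K x h else 0)"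
      by (intro sum.cong) (auto simp: Q_def)
    then show ?thesis using fin(3) \<open>y \<in> S\<close> by simp
  qed
  have KQ_B: "?KQ x (Inl l) = ?K x (Inl l) - (\<Sum>h\<in>M. ?K x (Inl h) * C l h)
      + (\<Sum>m=1..k. ?K x (Inr m) * (\<Sum>h\<in>M. V m h * w h * C l h))"
    if l: "l \<in> {1..n} - M" for x l
  proof -
    have lB: "Inl l \<in> B" using l by (simp add: B_def)
    have "?KQ x (Inl l) = (\<Sum>h\<in>A. ?K x h * Q h (Inl l)) + (\<Sum>h\<in>B. ?K x h * Q h (Inl l))"
      unfolding S_def using fin disj by (intro sum.union_disjoint) auto
    also have "(\<Sum>h\<in>B. ?K x h * Q h (Inl l)) = (\<Sum>h\<in>B. if h = Inl l then ?K x h else 0)"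
      using lB by (intro sum.cong) (auto simp: Q_def B_def)
    also have "\<dots> = ?K x (Inl l)" using fin(2) lB by simp
    also have "(\<Sum>h\<in>A. ?K x h * Q h (Inl l)) =
        (\<Sum>h\<in>M. ?K x (Inl h) * Q (Inl h) (Inl l)) + (\<Sum>m=1..k. ?K x (Inr m) * Q (Inr m) (Inl l))"
      unfolding A_def using finite_M by (simp add: sum.Plus)
    finally show ?thesis
      using lB by (simp add: Q_def sum_negf)
  qed
  have KQ_zero: "?KQ x y = 0" if "x \<in> A" "y \<in> B" for x y
  proof -
    obtain l where l: "l \<in> {1..n} - M" and y: "y = Inl l"
      using \<open>y \<in> B\<close> by (auto simp: B_def)
    consider i where "i \<in> M" "x = Inl i" | m where "m \<in> {1..k}" "x = Inr m"
      using \<open>x \<in> A\<close> unfolding A_def by blast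
    then show ?thesis
    proof cases
      case 1
      have "(\<Sum>h\<in>M. ?K x (Inl h) * C l h) = (\<Sum>h\<in>M. if h = i then w i * C l i else 0)"
        unfolding 1 by (intro sum.cong) auto
      also have "\<dots> = w i * C l i" using 1 finite_M by simp
      finally have *: "(\<Sum>h\<in>M. ?K x (Inl h) * C l h) = w i * C l i" .
      have "(\<Sum>m=1..k. ?K x (Inr m) * (\<Sum>h\<in>M. V m h * w h * C l h)) =
          (\<Sum>h\<in>M. C i h * (w h * C l h))"
        unfolding 1 C_def[of i] sum_distrib_left sum_distrib_right bordered_simps
        by (subst sum.swap) (simp add: mult.assoc)
      also have "\<dots> = (\<Sum>h\<in>M. if h = i then w i * C l i else 0)"
        using 1 by (intro sum.cong) (auto simp: C_M)
      also have "\<dots> = w i * C l i" using 1 finite_M by simp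
      finally show ?thesis
        unfolding y KQ_B[OF l] * using 1 l by auto
    next
      case 2
      have "(\<Sum>h\<in>M. ?K x (Inl h) * C l h) = b l m"
        using b_eq_C_b[OF 2(1), of l] by (simp add: 2 mult.commute)
      then show ?thesis
        unfolding y KQ_B[OF l] by (simp add: 2)
    qed
  qed
  have KQ_schur: "?KQ (Inl i) (Inl l) = schur w i l"
    if "i \<in> {1..n} - M" "l \<in> {1..n} - M" for i l
  proof -
    have "(\<Sum>h\<in>M. ?K (Inl i) (Inl h) * C l h) = 0"
      using that by (intro sum.neutral) auto
    moreover have "(\<Sum>m=1..k. ?K (Inl i) (Inr m) * (\<Sum>h\<in>M. V m h * w h * C l h)) =
        (\<Sum>h\<in>M. C i h * w h * C l h)"
      unfolding C_def[of i] sum_distrib_left sum_distrib_right bordered_simps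
      by (subst sum.swap) (simp add: mult.assoc)
    ultimately show ?thesis
      unfolding KQ_B[OF that(2)] schur_def by simp
  qed
  have det_Q: "set_det S Q = 1"
  proof -
    have "set_det (B \<union> A) Q = set_det B Q * set_det A Q"
      by (rule set_det_triangular) (use fin disj in \<open>auto simp: Q_def\<close>)
    also have "set_det B Q = 1"
      by (subst set_det_diagonal[where w = "\<lambda>_. 1"]) (use fin in \<open>auto simp: Q_def B_def\<close>)
    also have "set_det A Q = 1"
      by (subst set_det_diagonal[where w = "\<lambda>_. 1"]) (use fin disj in \<open>auto simp: Q_def\<close>)
    finally show ?thesis by (simp add: S_def Un_commute)
  qed
  have "set_det S ?K = set_det S ?KQ"
    using set_det_mult[OF fin(3), of ?K Q] det_Q by simp
  also have "\<dots> = set_det A ?KQ * set_det B ?KQ"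
    unfolding S_def by (rule set_det_triangular) (use fin disj KQ_zero in \<open>auto simp: S_def\<close>)
  also have "set_det A ?KQ = set_det A ?K"
    by (rule set_det_cong) (rule KQ_A)
  also have "\<dots> = (-1) ^ k * dsq k b M"
    unfolding A_def by (rule set_det_bordered_square[OF finite_M card_M])
  also have "set_det B ?KQ = set_det ({1..n} - M) (\<lambda>i l. ?KQ (Inl i) (Inl l))"
    by (rule set_det_reindex) (auto simp: B_def bij_betw_def)
  also have "\<dots> = set_det ({1..n} - M) (schur w)"
    by (rule set_det_cong) (rule KQ_schur)
  finally show ?thesis by (simp add: S_eq)
qed

end

section \<open>The critical set and its image by equations\<close>

text \<open>
  Along a coordinate line each \<open>f\<^sub>j\<close> is affine, and at the base point the quotient under the second
  logarithm is 1, away from the branch cut.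
\<close>

lemma master_branch_deriv:
  fixes F a c :: "nat \<Rightarrow> complex"
  assumes "\<And>j. j \<in> {1..n} \<Longrightarrow> F j \<noteq> 0"
  shows "((\<lambda>s. \<Sum>j=1..n. a j * (Ln (F j) + Ln ((F j + c j * (s - s0)) / F j)))
    has_field_derivative (\<Sum>j=1..n. a j * c j / F j)) (at (s0 :: complex))"
proof (intro DERIV_sum)
  fix j :: nat assume "j \<in> {1..n}"
  then have F: "F j \<noteq> 0" by (rule assms)
  show "((\<lambda>s. a j * (Ln (F j) + Ln ((F j + c j * (s - s0)) / F j)))
      has_field_derivative a j * c j / F j) (at s0)"
    using F by (auto intro!: derivative_eq_intros simp: field_simps)
qed

lemma ffun_update_t:
  assumes "i \<in> {1..k}"
  shows "ffun k b j z (t(i := s)) = ffun k b j z t + b j i * (s - t i)"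
proof -
  have "(\<Sum>m=1..k. b j m * (t(i := s)) m) =
      (\<Sum>m=1..k. b j m * t m + (if m = i then b j i * (s - t i) else 0))"
    by (intro sum.cong) (auto simp: algebra_simps)
  also have "\<dots> = (\<Sum>m=1..k. b j m * t m) + b j i * (s - t i)"
    using assms by (simp add: sum.distrib)
  finally show ?thesis by (simp add: ffun_def gfun_def)
qed

lemma dPhi_dt_eq:
  assumes "i \<in> {1..k}" and "\<And>j. j \<in> {1..n} \<Longrightarrow> ffun k b j z t \<noteq> 0"
  shows "dPhi_dt n k b a i z t = (\<Sum>j=1..n. a j * b j i / ffun k b j z t)"
  unfolding dPhi_dt_def master_def ffun_update_t[OF assms(1)]
  by (rule DERIV_imp_deriv, rule master_branch_deriv) (rule assms(2))

lemma dPhi_dz_eq: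
  assumes "i \<in> {1..n}" and "\<And>j. j \<in> {1..n} \<Longrightarrow> ffun k b j z t \<noteq> 0"
  shows "dPhi_dz n k b a i z t = a i / ffun k b i z t"
proof -
  have upd: "ffun k b j (z(i := s)) t = ffun k b j z t + (if j = i then 1 else 0) * (s - z i)" for j s
    by (simp add: ffun_def)
  have "dPhi_dz n k b a i z t = (\<Sum>j=1..n. a j * (if j = i then 1 else 0) / ffun k b j z t)"
    unfolding dPhi_dz_def master_def upd
    by (rule DERIV_imp_deriv, rule master_branch_deriv) (rule assms(2))
  also have "\<dots> = (\<Sum>j=1..n. if j = i then a i / ffun k b i z t else 0)"
    by (intro sum.cong) auto
  finally show ?thesis using assms(1) by simp
qed

text \<open>
  \<open>\<Lambda>\<close> by equations: since \<open>p\<^sub>j = a\<^sub>j / f\<^sub>j\<close>, the critical point equations become linear in \<open>p\<close>, and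
  \<open>t\<close> enters only through \<open>f\<^sub>j = a\<^sub>j / p\<^sub>j\<close>.
\<close>

lemma Lam_iff:
  assumes a: "\<forall>j\<in>{1..n}. a j \<noteq> 0"
  shows "(z, p) \<in> Lam n k b a \<longleftrightarrow>
    z \<in> cspace n \<and> z \<notin> Delta n k b \<and> p \<in> cspace n \<and> (\<forall>j\<in>{1..n}. p j \<noteq> 0) \<and>
    (\<forall>m\<in>{1..k}. (\<Sum>j=1..n. b j m * p j) = 0) \<and>
    (\<exists>t. \<forall>j\<in>{1..n}. z j + gfun k b j t = a j / p j)"
  (is "?L \<longleftrightarrow> ?R")
proof
  assume ?L
  then obtain t where zt: "(z, t) \<in> crit_set n k b a"
    and p: "p = (\<lambda>j\<in>{1..n}. dPhi_dz n k b a j z t)"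
    unfolding Lam_def phi_map_def by auto
  from zt have f: "\<And>j. j \<in> {1..n} \<Longrightarrow> ffun k b j z t \<noteq> 0"
    and z: "z \<in> cspace n" "z \<notin> Delta n k b"
    and crit: "\<And>i. i \<in> {1..k} \<Longrightarrow> dPhi_dt n k b a i z t = 0"
    by (auto simp: crit_set_def U0_def)
  have p_eq: "p j = a j / ffun k b j z t" if "j \<in> {1..n}" for j
    using that dPhi_dz_eq[OF that f] by (simp add: p)
  have "(\<Sum>j=1..n. b j m * p j) = 0" if m: "m \<in> {1..k}" for m
  proof -
    have "(\<Sum>j=1..n. b j m * p j) = (\<Sum>j=1..n. a j * b j m / ffun k b j z t)"
      by (intro sum.cong refl) (simp add: p_eq)
    then show ?thesis using dPhi_dt_eq[OF m f] crit[OF m] by simp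
  qed
  moreover have "z j + gfun k b j t = a j / p j" if "j \<in> {1..n}" for j
    using f[OF that] bspec[OF a that] by (simp add: p_eq[OF that]) (simp add: ffun_def)
  moreover have "p j \<noteq> 0" if "j \<in> {1..n}" for j
    using f[OF that] bspec[OF a that] by (simp add: p_eq[OF that])
  moreover have "p \<in> cspace n" unfolding p by (rule restrict_PiE_iff[THEN iffD2]) simp
  ultimately show ?R using z by blast
next
  assume R: ?R
  then obtain t' where t': "\<forall>j\<in>{1..n}. z j + gfun k b j t' = a j / p j" by blast
  define t where "t = restrict t' {1..k}"
  have "gfun k b j t = gfun k b j t'" for j
    unfolding gfun_def t_def by (intro sum.cong) auto
  with t' have f: "ffun k b j z t = a j / p j" if "j \<in> {1..n}" for j
    using that by (simp add: ffun_def)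
  then have nz: "ffun k b j z t \<noteq> 0" if "j \<in> {1..n}" for j
    using that a R by simp
  have "dPhi_dt n k b a i z t = 0" if i: "i \<in> {1..k}" for i
  proof -
    have "dPhi_dt n k b a i z t = (\<Sum>j=1..n. b j i * p j)"
      proof -
      have "dPhi_dt n k b a i z t = (\<Sum>j=1..n. a j * b j i / ffun k b j z t)"
        by (rule dPhi_dt_eq[OF i nz])
      also have "\<dots> = (\<Sum>j=1..n. b j i * p j)"
        by (intro sum.cong refl) (use f a in simp)
      finally show ?thesis .
    qed
    then show ?thesis using R i by simp
  qed
  moreover have "(z, t) \<in> U0 n k b"
    using R nz by (auto simp: U0_def t_def)
  ultimately have "(z, t) \<in> crit_set n k b a" by (auto simp: crit_set_def)
  moreover have "p = (\<lambda>j\<in>{1..n}. dPhi_dz n k b a j z t)"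
  proof (rule extensionalityI[of _ "{1..n}"])
    fix j assume j: "j \<in> {1..n}"
    show "p j = (\<lambda>j\<in>{1..n}. dPhi_dz n k b a j z t) j"
      using j f[OF j] bspec[OF a j] dPhi_dz_eq[OF j nz] by simp
  qed (use R in \<open>auto simp: PiE_def\<close>)
  ultimately show ?L unfolding Lam_def phi_map_def by (intro image_eqI[where x = "(z, t)"]) auto
qed

lemma isCont_eventually_nonzero:
  fixes f :: "complex \<Rightarrow> complex"
  assumes "isCont f x" "f x \<noteq> 0"
  shows "\<forall>\<^sub>F s in nhds x. f s \<noteq> 0"
  using assms by (simp add: isCont_def tendsto_at_iff_tendsto_nhds tendsto_imp_eventually_ne)

text \<open>
  The discriminant is a finite union of hyperplanes, so leaving it is an open condition.  It
  is one of the two open conditions on \<open>\<Lambda>\<close>, the other being \<open>p\<^sub>j \<noteq> 0\<close>; the remaining equations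
  are solved exactly by the inverse of the coordinates.
\<close>

lemma eventually_not_Delta:
  assumes "\<And>j. j \<in> {1..n} \<Longrightarrow> isCont (\<lambda>s. x s j) s0"
    and "x s0 \<notin> Delta n k b" and "\<And>s. x s \<in> cspace n"
  shows "\<forall>\<^sub>F s in nhds (s0 :: complex). x s \<notin> Delta n k b"
proof -
  let ?I = "{is. length is = k + 1 \<and> sorted_wrt (<) is \<and> set is \<subseteq> {1..n}}"
  have "finite ?I"
    by (rule finite_subset[OF _ finite_lists_length_eq[of "{1..n}" "k + 1"]]) auto
  moreover have "\<forall>\<^sub>F s in nhds s0. fcirc k b is (x s) \<noteq> 0" if "is \<in> ?I" for "is"
  proof -
    have "is ! (m - 1) \<in> {1..n}" if "m \<in> {1..k + 1}" for m
    proof -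
      have "is ! (m - 1) \<in> set is" using that \<open>is \<in> ?I\<close> by (intro nth_mem) auto
      then show ?thesis using \<open>is \<in> ?I\<close> by blast
    qed
    then have "isCont (\<lambda>s. fcirc k b is (x s)) s0"
      unfolding fcirc_def by (intro continuous_intros assms(1)) auto
    moreover have "fcirc k b is (x s0) \<noteq> 0"
      using assms(2,3) that by (auto simp: Delta_def)
    ultimately show ?thesis
      by (rule isCont_eventually_nonzero)
  qed
  ultimately have "\<forall>\<^sub>F s in nhds s0. \<forall>is\<in>?I. fcirc k b is (x s) \<noteq> 0"
    by (intro eventually_ball_finite ballI)
  then show ?thesis
    by eventually_elim (auto simp: Delta_def)
qed

section \<open>Coordinates on the image and the Jacobian\<close>

context complementary_chart
begin

text \<open>
  The inverse of the coordinate map: \<open>p\<^sub>M\<close> is found from the linear relations, and \<open>z\<close> outside \<open>M\<close>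
  by eliminating \<open>t\<close> with the equations \<open>g\<^sub>h(t) = a\<^sub>h / p\<^sub>h - z\<^sub>h\<close>, \<open>h \<in> M\<close>.
\<close>

definition p_of :: "(nat \<Rightarrow> complex) \<Rightarrow> nat \<Rightarrow> complex" where
  "p_of c i = (if i \<in> M then - (\<Sum>l\<in>{1..n} - M. C l i * c l) else c i)"

definition z_of :: "(nat \<Rightarrow> complex) \<Rightarrow> nat \<Rightarrow> complex" where
  "z_of c i = (if i \<in> M then c i
     else a i / c i - (\<Sum>h\<in>M. C i h * (a h / p_of c h - c h)))"

lemmas Lam_iff_chart = Lam_iff[OF a_nonzero]

lemma sum_split_M: "(\<Sum>j=1..n. f j) = (\<Sum>j\<in>M. f j) + (\<Sum>j\<in>{1..n} - M. f j)"
  for f :: "nat \<Rightarrow> complex"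
  using sum.subset_diff[OF M_subset, of f] by (simp add: add.commute)

lemma gfun_eq_C: "(\<Sum>h\<in>M. C i h * gfun k b h t) = gfun k b i t"
proof -
  have "(\<Sum>h\<in>M. C i h * gfun k b h t) = (\<Sum>m=1..k. (\<Sum>h\<in>M. C i h * b h m) * t m)"
    unfolding gfun_def sum_distrib_left sum_distrib_right
    by (subst sum.swap) (simp add: mult.assoc)
  also have "\<dots> = gfun k b i t"
    unfolding gfun_def by (intro sum.cong refl arg_cong2[of _ _ _ _ "(*)"] b_eq_C_b)
  finally show ?thesis .
qed

text \<open>
  The parameter \<open>t\<close> of this shape solves \<open>g\<^sub>h(t) = u\<^sub>h\<close> for \<open>h \<in> M\<close>.
\<close>

lemma gfun_solution:
  "gfun k b i (\<lambda>m. \<Sum>h\<in>M. V m h * u h) = (\<Sum>h\<in>M. C i h * u h)"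
  unfolding gfun_def C_def sum_distrib_left sum_distrib_right
  by (subst sum.swap) (simp add: mult.assoc)

text \<open>
  A point of \<open>\<Lambda>\<close> is determined by its coordinates: the matrix of the relations between the \<open>p\<^sub>j\<close>
  is invertible on \<open>M\<close>, and \<open>t\<close> is determined by the values \<open>g\<^sub>h(t)\<close>, \<open>h \<in> M\<close>.
\<close>

lemma Lam_recover:
  assumes q: "(z, p) \<in> Lam n k b a" and i: "i \<in> {1..n}"
  shows "p i = p_of (coords n M (z, p)) i" and "z i = z_of (coords n M (z, p)) i"
proof -
  let ?c = "coords n M (z, p)"
  have R: "\<forall>m\<in>{1..k}. (\<Sum>j=1..n. b j m * p j) = 0"
    "\<exists>t. \<forall>j\<in>{1..n}. z j + gfun k b j t = a j / p j"
    using q unfolding Lam_iff_chart by simp_all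
  then obtain t where t: "\<And>j. j \<in> {1..n} \<Longrightarrow> gfun k b j t = a j / p j - z j"
    by (metis add_diff_cancel_left')
  have c_M: "?c h = z h" if "h \<in> M" for h
    using that M_subset by (auto simp: coords_def)
  have c_notM: "?c l = p l" if "l \<in> {1..n} - M" for l
    using that by (auto simp: coords_def)
  have p_M: "p h = p_of ?c h" if h: "h \<in> M" for h
  proof -
    \<comment> \<open>combining the relations \<open>\<Sum>\<^sub>j b\<^sub>j\<^sup>m p\<^sub>j = 0\<close> with column \<open>h\<close> of \<open>V\<close> isolates \<open>p\<^sub>h\<close>\<close>
    have "(\<Sum>j=1..n. C j h * p j) = (\<Sum>m=1..k. V m h * (\<Sum>j=1..n. b j m * p j))"
      unfolding C_def sum_distrib_left sum_distrib_right
      by (subst sum.swap) (simp add: mult_ac)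
    also have "\<dots> = 0" using R(1) by (intro sum.neutral) simp
    finally have "(\<Sum>j\<in>M. C j h * p j) + (\<Sum>l\<in>{1..n} - M. C l h * p l) = 0"
      unfolding sum_split_M .
    moreover have "(\<Sum>j\<in>M. C j h * p j) = (\<Sum>j\<in>M. if j = h then p h else 0)"
      using h by (intro sum.cong) (auto simp: C_M)
    moreover have "\<dots> = p h" using h finite_M by simp
    moreover have "(\<Sum>l\<in>{1..n} - M. C l h * p l) = (\<Sum>l\<in>{1..n} - M. C l h * ?c l)"
      by (intro sum.cong refl) (simp add: c_notM)
    ultimately show ?thesis
      using h by (simp add: p_of_def eq_neg_iff_add_eq_0)
  qed
  show p_i: "p i = p_of ?c i"
  proof (cases "i \<in> M")
    case False
    then show ?thesis using i c_notM[of i] by (simp add: p_of_def)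
  qed (rule p_M)
  show "z i = z_of ?c i"
  proof (cases "i \<in> M")
    case True
    then show ?thesis by (simp add: z_of_def c_M)
  next
    case False
    have "(\<Sum>h\<in>M. C i h * (a h / p_of ?c h - ?c h)) = (\<Sum>h\<in>M. C i h * gfun k b h t)"
      using M_subset by (intro sum.cong refl) (auto simp: p_M c_M t)
    also have "\<dots> = a i / p i - z i" by (simp add: gfun_eq_C t[OF i])
    finally show ?thesis
      using False i c_notM[of i] by (simp add: z_of_def)
  qed
qed

lemma inj_on_coords: "inj_on (coords n M) (Lam n k b a)"
proof (rule inj_onI, clarsimp)
  fix z p z' p'
  assume q: "(z, p) \<in> Lam n k b a" and q': "(z', p') \<in> Lam n k b a"
    and eq: "coords n M (z, p) = coords n M (z', p')"
  have ext: "z \<in> cspace n" "p \<in> cspace n" "z' \<in> cspace n" "p' \<in> cspace n"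
    using q q' unfolding Lam_iff_chart by simp_all
  have "z i = z' i" "p i = p' i" if "i \<in> {1..n}" for i
    using Lam_recover[OF q that] Lam_recover[OF q' that] by (simp_all only: eq)
  then show "z = z' \<and> p = p'"
    by (intro conjI PiE_ext[OF ext(1,3)] PiE_ext[OF ext(2,4)])
qed

text \<open>
  Conversely, the formulas produce points of \<open>\<Lambda>\<close>, so the image of the coordinates is cut out
  by the open conditions alone.
\<close>

lemma chart_in_Lam:
  assumes c: "c \<in> cspace n" and nz: "\<And>i. i \<in> {1..n} \<Longrightarrow> p_of c i \<noteq> 0"
    and nD: "restrict (z_of c) {1..n} \<notin> Delta n k b"
  shows "(restrict (z_of c) {1..n}, restrict (p_of c) {1..n}) \<in> Lam n k b a"
    and "coords n M (restrict (z_of c) {1..n}, restrict (p_of c) {1..n}) = c"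
proof -
  define u where "u h = a h / p_of c h - c h" for h
  define t where "t m = (\<Sum>h\<in>M. V m h * u h)" for m
  have g: "gfun k b i t = (\<Sum>h\<in>M. C i h * u h)" for i
    unfolding t_def[abs_def] by (rule gfun_solution)
  have "z_of c i + gfun k b i t = a i / p_of c i" if "i \<in> {1..n}" for i
  proof (cases "i \<in> M")
    case True
    have "(\<Sum>h\<in>M. C i h * u h) = (\<Sum>h\<in>M. if h = i then u i else 0)"
      using True by (intro sum.cong) (auto simp: C_M)
    also have "\<dots> = u i" using True finite_M by simp
    finally show ?thesis using True by (simp add: g z_of_def u_def)
  next
    case False
    then show ?thesis by (simp add: g z_of_def u_def p_of_def)
  qed
  moreover have "(\<Sum>j=1..n. b j m * p_of c j) = 0" if m: "m \<in> {1..k}" for m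
  proof -
    have "(\<Sum>j\<in>M. b j m * p_of c j) = - (\<Sum>j\<in>M. \<Sum>l\<in>{1..n} - M. b j m * (C l j * c l))"
      by (simp add: p_of_def sum_distrib_left sum_negf)
    also have "(\<Sum>j\<in>M. \<Sum>l\<in>{1..n} - M. b j m * (C l j * c l)) =
        (\<Sum>l\<in>{1..n} - M. (\<Sum>j\<in>M. C l j * b j m) * c l)"
      unfolding sum_distrib_right by (subst sum.swap) (simp add: mult_ac)
    also have "\<dots> = (\<Sum>l\<in>{1..n} - M. b l m * p_of c l)"
      by (intro sum.cong refl) (simp add: b_eq_C_b[OF m] p_of_def)
    finally show ?thesis unfolding sum_split_M by simp
  qed
  ultimately show "(restrict (z_of c) {1..n}, restrict (p_of c) {1..n}) \<in> Lam n k b a"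
    unfolding Lam_iff_chart using nz nD by (auto intro!: exI[of _ t])
  show "coords n M (restrict (z_of c) {1..n}, restrict (p_of c) {1..n}) = c"
  proof (rule extensionalityI[of _ "{1..n}"])
    fix j assume "j \<in> {1..n}"
    then show "coords n M (restrict (z_of c) {1..n}, restrict (p_of c) {1..n}) j = c j"
      by (auto simp: coords_def z_of_def p_of_def)
  qed (use c in \<open>auto simp: coords_def PiE_def\<close>)
qed

lemma p_of_deriv:
  assumes "i \<in> {1..n}" "l \<in> {1..n} - M"
  shows "((\<lambda>s. p_of (c(l := s)) i) has_field_derivative
    (if i \<in> M then - C l i else if i = l then 1 else 0)) (at s0)"
proof (cases "i \<in> M")
  case True
  have "(\<Sum>j\<in>{1..n} - M. C j i * (c(l := s)) j) =
      C l i * s + (\<Sum>j\<in>{1..n} - M - {l}. C j i * c j)" for s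
    using assms(2) by (subst sum.remove[of _ l]) auto
  then show ?thesis using True by (auto simp: p_of_def intro!: derivative_eq_intros)
next
  case False
  then show ?thesis by (auto simp: p_of_def intro!: derivative_eq_intros)
qed

lemma p_of_update_M:
  assumes "l \<in> M" "i \<in> {1..n}"
  shows "p_of (c(l := s)) i = p_of c i"
proof -
  have "(\<Sum>j\<in>{1..n} - M. C j i * (c(l := s)) j) = (\<Sum>j\<in>{1..n} - M. C j i * c j)"
    using assms(1) by (intro sum.cong) auto
  then show ?thesis using assms by (auto simp: p_of_def)
qed

lemma isCont_p_of:
  assumes "i \<in> {1..n}" "l \<in> {1..n}"
  shows "isCont (\<lambda>s. p_of (c(l := s)) i) s0"
proof (cases "l \<in> M")
  case True
  then show ?thesis using p_of_update_M[of l i c] assms by simp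
next
  case False
  then show ?thesis using DERIV_isCont[OF p_of_deriv[OF assms(1)]] assms(2) by blast
qed

lemma isCont_z_of:
  assumes i: "i \<in> {1..n}" and l: "l \<in> {1..n}" and nz: "\<And>j. j \<in> {1..n} \<Longrightarrow> p_of c j \<noteq> 0"
  shows "isCont (\<lambda>s. z_of (c(l := s)) i) (c l)"
proof (cases "i \<in> M")
  case True
  then show ?thesis by (cases "i = l") (auto simp: z_of_def)
next
  case False
  have upd: "isCont (\<lambda>s. (c(l := s)) j) (c l)" for j
    by (cases "j = l") auto
  have "c i \<noteq> 0" using nz[OF i] False by (simp add: p_of_def)
  moreover have "isCont (\<lambda>s. p_of (c(l := s)) h) (c l)" if "h \<in> M" for h
    using isCont_p_of[where i = h and l = l and c = c] that M_subset l by blast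
  moreover have "p_of c h \<noteq> 0" if "h \<in> M" for h using nz that M_subset by blast
  ultimately show ?thesis
    unfolding z_of_def using False upd
    by (simp del: fun_upd_apply)
qed

text \<open>
  The variable \<open>p\<^sub>l\<close> moves \<open>z\<^sub>i\<close> directly when \<open>i = l\<close>, and through each \<open>p\<^sub>h\<close>, \<open>h \<in> M\<close>, with
  \<open>\<partial>p\<^sub>h/\<partial>p\<^sub>l = - C\<^sub>l\<^sub>h\<close>; together this is the Schur complement.
\<close>

lemma z_of_deriv:
  assumes i: "i \<in> {1..n} - M" and l: "l \<in> {1..n} - M"
    and nz: "\<And>j. j \<in> {1..n} \<Longrightarrow> p_of c j \<noteq> 0"
  shows "((\<lambda>s. z_of (c(l := s)) i) has_field_derivative
    - schur (\<lambda>j. a j / (p_of c j)\<^sup>2) i l) (at (c l))"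
proof -
  have ci: "p_of c i = c i" "c i \<noteq> 0" using nz[of i] i by (auto simp: p_of_def)
  have first: "((\<lambda>s. a i / (c(l := s)) i) has_field_derivative
      - (if i = l then a i / (c i)\<^sup>2 else 0)) (at (c l))"
    using ci by (auto intro!: derivative_eq_intros simp: power2_eq_square)
  have second: "((\<lambda>s. C i h * (a h / p_of (c(l := s)) h - (c(l := s)) h)) has_field_derivative
      C i h * (a h / (p_of c h)\<^sup>2) * C l h) (at (c l))" if h: "h \<in> M" for h
  proof -
    have hn: "h \<in> {1..n}" and "h \<noteq> l" using h l M_subset by auto
    have "((\<lambda>s. p_of (c(l := s)) h) has_field_derivative - C l h) (at (c l))"
      using p_of_deriv[OF hn l, of c "c l"] h by simp
    then show ?thesis
      using nz[OF hn] \<open>h \<noteq> l\<close>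
      by (auto intro!: derivative_eq_intros simp: power2_eq_square field_simps)
  qed
  have "((\<lambda>s. a i / (c(l := s)) i - (\<Sum>h\<in>M. C i h * (a h / p_of (c(l := s)) h - (c(l := s)) h)))
      has_field_derivative - (if i = l then a i / (c i)\<^sup>2 else 0)
        - (\<Sum>h\<in>M. C i h * (a h / (p_of c h)\<^sup>2) * C l h)) (at (c l))"
    by (intro DERIV_diff DERIV_sum first second)
  moreover have "(\<lambda>s. z_of (c(l := s)) i) = (\<lambda>s.
      a i / (c(l := s)) i - (\<Sum>h\<in>M. C i h * (a h / p_of (c(l := s)) h - (c(l := s)) h)))"
    using i by (intro ext) (simp add: z_of_def)
  moreover have "- schur (\<lambda>j. a j / (p_of c j)\<^sup>2) i l = - (if i = l then a i / (c i)\<^sup>2 else 0)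
        - (\<Sum>h\<in>M. C i h * (a h / (p_of c h)\<^sup>2) * C l h)"
    using ci(1) by (cases "i = l") (simp_all add: schur_def)
  ultimately show ?thesis by simp
qed

text \<open>
  A small change of one coordinate stays in the image of \<open>\<Lambda>\<close>, so there the abstract inverse in
  the definition of the Jacobian is given by the explicit formulas.
\<close>

lemma eventually_inv_into_coords:
  assumes q: "(z, p) \<in> Lam n k b a" and l: "l \<in> {1..n}"
  defines "c \<equiv> coords n M (z, p)"
  shows "\<forall>\<^sub>F s in nhds (c l).
    fst (inv_into (Lam n k b a) (coords n M) (c(l := s))) = restrict (z_of (c(l := s))) {1..n}"
proof -
  have R: "z \<in> cspace n" "z \<notin> Delta n k b" "\<forall>j\<in>{1..n}. p j \<noteq> 0"
    using q unfolding Lam_iff_chart by simp_all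
  have c: "c(l := s) \<in> cspace n" for s
    using l by (auto simp: c_def coords_def PiE_def extensional_def)
  have p_c: "p_of c i = p i" "z_of c i = z i" if "i \<in> {1..n}" for i
    using Lam_recover[OF q that] by (simp_all add: c_def)
  have nz: "p_of c i \<noteq> 0" if "i \<in> {1..n}" for i using R(3) p_c that by simp
  have "\<forall>\<^sub>F s in nhds (c l). \<forall>i\<in>{1..n}. p_of (c(l := s)) i \<noteq> 0"
  proof (rule eventually_ball_finite)
    show "\<forall>i\<in>{1..n}. \<forall>\<^sub>F s in nhds (c l). p_of (c(l := s)) i \<noteq> 0"
      using isCont_p_of[OF _ l, where c = c and ?s0.0 = "c l"] nz
      by (auto intro: isCont_eventually_nonzero)
  qed simp
  moreover have "\<forall>\<^sub>F s in nhds (c l). restrict (z_of (c(l := s))) {1..n} \<notin> Delta n k b"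
  proof (rule eventually_not_Delta)
    show "isCont (\<lambda>s. restrict (z_of (c(l := s))) {1..n} j) (c l)" if "j \<in> {1..n}" for j
      using isCont_z_of[OF that l nz] that by simp
    have "restrict (z_of c) {1..n} = z"
      using R(1) p_c by (intro extensionalityI[of _ "{1..n}"]) (auto simp: PiE_def)
    then show "restrict (z_of (c(l := c l))) {1..n} \<notin> Delta n k b" using R(2) by simp
  qed auto
  ultimately show ?thesis
  proof eventually_elim
    case (elim s)
    have "inv_into (Lam n k b a) (coords n M) (c(l := s)) =
        (restrict (z_of (c(l := s))) {1..n}, restrict (p_of (c(l := s))) {1..n})"
      using chart_in_Lam[OF c, of s] elim by (intro inv_into_f_eq[OF inj_on_coords]) auto
    then show ?case by simp
  qed
qed

text \<open>
  The Jacobian matrix is block triangular because \<open>z\<^sub>i\<close> with \<open>i \<in> M\<close> is itself a coordinate.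
\<close>

lemma Jac_eq_schur:
  assumes q: "(z, p) \<in> Lam n k b a"
  shows "Jac n (Lam n k b a) M (z, p) =
    (-1) ^ (n - k) * set_det ({1..n} - M) (schur (\<lambda>j. a j / (p j)\<^sup>2))"
proof -
  define c where "c = coords n M (z, p)"
  let ?w = "\<lambda>j. a j / (p j)\<^sup>2"
  define D where "D i l = deriv (\<lambda>s. fst (inv_into (Lam n k b a) (coords n M) (c(l := s))) i) (c l)"
    for i l
  have p_c: "p_of c i = p i" if "i \<in> {1..n}" for i
    using Lam_recover(1)[OF q that] by (simp add: c_def)
  have nz: "p_of c i \<noteq> 0" if "i \<in> {1..n}" for i
    using q p_c[OF that] that unfolding Lam_iff_chart by simp
  have D: "D i l = deriv (\<lambda>s. z_of (c(l := s)) i) (c l)"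
    if i: "i \<in> {1..n}" and l: "l \<in> {1..n}" for i l
  proof -
    have "\<forall>\<^sub>F s in nhds (c l). fst (inv_into (Lam n k b a) (coords n M) (c(l := s))) i
        = z_of (c(l := s)) i"
      using eventually_inv_into_coords[OF q l, folded c_def]
      by eventually_elim (use i in simp)
    then show ?thesis
      unfolding D_def by (rule deriv_cong_ev) simp
  qed
  have D_M: "D i l = (if i = l then 1 else 0)" if "i \<in> M" "l \<in> {1..n}" for i l
    using that M_subset D[of i l] by (cases "i = l") (auto simp: z_of_def)
  have D_schur: "D i l = - schur ?w i l" if i: "i \<in> {1..n} - M" and l: "l \<in> {1..n} - M" for i l
  proof -
    have "D i l = - schur (\<lambda>j. a j / (p_of c j)\<^sup>2) i l"
      using D[of i l] DERIV_imp_deriv[OF z_of_deriv[OF i l nz]] i l by simp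
    also have "schur (\<lambda>j. a j / (p_of c j)\<^sup>2) i l = schur ?w i l"
      unfolding schur_def using i M_subset
      by (intro arg_cong2[of _ _ _ _ "(+)"] sum.cong) (auto simp: p_c)
    finally show ?thesis .
  qed
  have "Jac n (Lam n k b a) M (z, p) = set_det {0..<n} (\<lambda>i l. D (Suc i) (Suc l))"
    unfolding Jac_def det_eq_set_det c_def[symmetric] D_def ..
  also have "\<dots> = set_det {1..n} D"
    by (rule set_det_reindex[symmetric])
      (auto simp: bij_betw_def atLeastLessThanSuc_atLeastAtMost)
  also have "\<dots> = set_det (M \<union> ({1..n} - M)) D"
    using M_subset by (simp add: Un_absorb1)
  also have "\<dots> = set_det M D * set_det ({1..n} - M) D"
    by (rule set_det_triangular) (use finite_M D_M in auto)
  also have "set_det M D = 1"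
    by (subst set_det_diagonal[where w = "\<lambda>_. 1"]) (use finite_M M_subset D_M in auto)
  also have "set_det ({1..n} - M) D = set_det ({1..n} - M) (\<lambda>i l. - schur ?w i l)"
    by (rule set_det_cong) (rule D_schur)
  also have "\<dots> = (-1) ^ card ({1..n} - M) * set_det ({1..n} - M) (schur ?w)"
    by (rule set_det_uminus) simp
  also have "card ({1..n} - M) = n - k"
    using M_subset finite_M card_M by (simp add: card_Diff_subset)
  finally show ?thesis by simp
qed

end

section \<open>The Jacobian formula\<close>

text \<open>
  Both evaluations of the determinant of the bordered matrix are compared, and the common sign
  \<open>(-1)\<^sup>k\<close> cancels.
\<close>

lemma dsq_times_Jac:
  assumes kn: "k < n"
    and minors: "\<forall>is. length is = k \<and> distinct is \<and> set is \<subseteq> {1..n} \<longrightarrow> dminor k b is \<noteq> 0"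
    and a: "\<forall>j\<in>{1..n}. a j \<noteq> 0"
    and M: "M \<subseteq> {1..n}" "card M = k"
    and q: "(z, p) \<in> Lam n k b a"
  shows "dsq k b M * Jac n (Lam n k b a) M (z, p) =
    (-1) ^ (n - k) * (\<Sum>L | L \<subseteq> {1..n} \<and> card L = n - k.
       dsq k b ({1..n} - L) * (\<Prod>j\<in>L. a j / (p j)\<^sup>2))"
proof -
  have finM: "finite M" using M(1) finite_subset by blast
  have "dminor k b (sorted_list_of_set M) \<noteq> 0"
    using minors M finM by simp
  from dminor_inverse[OF finM M(2) this] obtain V where
    V: "\<forall>i\<in>M. \<forall>h\<in>M. (\<Sum>m=1..k. b i m * V m h) = (if i = h then 1 else 0)"
    "\<forall>m\<in>{1..k}. \<forall>m'\<in>{1..k}. (\<Sum>i\<in>M. V m i * b i m') = (if m = m' then 1 else 0)"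
    by blast
  interpret complementary_chart n k b a M V
    by unfold_locales (use M a V in blast)+
  let ?w = "\<lambda>j. a j / (p j)\<^sup>2"
  let ?N = "set_det ({1..n} - M) (schur ?w)"
  have "(-1) ^ k * (dsq k b M * ?N) = set_det ({1..n} <+> {1..k}) (bordered ?w b)"
    unfolding set_det_bordered_schur by simp
  also have "\<dots> = (-1) ^ k * (\<Sum>L | L \<subseteq> {1..n} \<and> card L = n - k.
       dsq k b ({1..n} - L) * (\<Prod>j\<in>L. ?w j))"
    using set_det_bordered_expansion[of "{1..n}" k ?w b] kn by simp
  finally have "dsq k b M * ?N = (\<Sum>L | L \<subseteq> {1..n} \<and> card L = n - k.
       dsq k b ({1..n} - L) * (\<Prod>j\<in>L. ?w j))"
    by simp
  then show ?thesis
    by (simp add: Jac_eq_schur[OF q] mult.left_commute)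
qed

theorem theorem3p8:
  fixes n k :: nat
    and b :: "nat \<Rightarrow> nat \<Rightarrow> complex"
    and a :: "nat \<Rightarrow> complex"
  assumes "0 < k" and "k < n"
    and "\<forall>is. length is = k \<and> distinct is \<and> set is \<subseteq> {1..n} \<longrightarrow> dminor k b is \<noteq> 0"
    and "\<forall>j\<in>{1..n}. a j \<noteq> 0"
    and "(\<Sum>j=1..n. a j) \<noteq> 0"
  shows "(\<forall>M M'. M \<subseteq> {1..n} \<and> card M = k \<and> M' \<subseteq> {1..n} \<and> card M' = k \<longrightarrow>
            (\<forall>q\<in>Lam n k b a.
               dsq k b M * Jac n (Lam n k b a) M q = dsq k b M' * Jac n (Lam n k b a) M' q)) \<and>
         (\<forall>M. M \<subseteq> {1..n} \<and> card M = k \<longrightarrow>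
            (\<forall>(z, p)\<in>Lam n k b a.
               dsq k b M * Jac n (Lam n k b a) M (z, p) =
                 (-1) ^ (n - k) *
                 (\<Sum>L | L \<subseteq> {1..n} \<and> card L = n - k.
                    dsq k b ({1..n} - L) * (\<Prod>j\<in>L. a j / (p j)\<^sup>2))))"
  using dsq_times_Jac[OF assms(2-4)] by auto

end
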